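(* Let $N\ge 2$ and $K\ge 1$ be integers, let $\alpha_k,\beta_k,\delta_k>0$ for $k=1,\dots,K$, and let $x(t)$ be the inhomogeneous symmetric simple exclusion process with open boundaries on $G=\{0,1,\dots,K\}^N$ with these rates. If $\alpha_k=\beta_k$ for all $k=1,\dots,K$, then the steady probability is the same for every state, namely $$p(x_1,\dots,x_N)=\frac{1}{(K+1)^N}$$ for all integers $x_1,\dots,x_N$ with $0\le x_1,\dots,x_N\le K$.
   Context: The process: $x(t)=(x_1(t),\dots,x_N(t))$, $t\ge0$, is a continuous-time Markov chain with finite state space $G=\{0,1,\dots,K\}^N$. Sites are numbered $1,\dots,N$ from left to right; $x_i=0$ means that site $i$ is vacant, and $x_i=k\in\{1,\dots,K\}$ means that site $i$ is occupied by a particle of type $k$. The transitions and their rates are, for each $k=1,\dots,K$: (arrival) for $i=1$ and for $i=N$, if $x_i=0$, then $x_i$ changes to $k$ at rate $\alpha_k$ (a particle of type $k$ enters from outside); (departure) for $i=1$ and for $i=N$, if $x_i=k$, then $x_i$ changes to $0$ at rate $\beta_k$ (the particle leaves the system); (hop) for any two adjacent sites $i,j\in\{1,\dots,N\}$, $|i-j|=1$, if $x_i=k$ and $x_j=0$, then the particle in site $i$ moves to site $j$ (so $x_i$ becomes $0$ and $x_j$ becomes $k$) at rate $\delta_k$. No other transitions occur. Steady probabilities: $p(x_1,\dots,x_N)$ denotes the steady (limiting as $t\to\infty$, equivalently stationary) probability of the state $(x_1,\dots,x_N)\in G$ of this chain. *)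

theory Defs
  imports "HOL-Probability.Probability"
begin

definition generator :: "'s set \<Rightarrow> ('s \<Rightarrow> 's \<Rightarrow> real) \<Rightarrow> 's \<Rightarrow> 's \<Rightarrow> real" where
  "generator S q x y = (if x = y then - (\<Sum>z\<in>S - {x}. q x z) else q x y)"

text \<open>
  The last condition says \<open>P h x y = of_bool (x = y) + h * generator S q x y + o(h)\<close> as \<open>h\<close>
  decreases to 0, so for \<open>x \<noteq> y\<close> the chain jumps from \<open>x\<close> to \<open>y\<close> at rate \<open>q x y\<close>.
  On a finite \<open>S\<close> these conditions determine \<open>P t x y\<close> for \<open>t \<ge> 0\<close> and \<open>x, y \<in> S\<close>.
\<close>

definition transition_function ::
  "'s set \<Rightarrow> ('s \<Rightarrow> 's \<Rightarrow> real) \<Rightarrow> (real \<Rightarrow> 's \<Rightarrow> 's \<Rightarrow> real) \<Rightarrow> bool" where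
  "transition_function S q P \<longleftrightarrow>
     (\<forall>t\<ge>0. \<forall>x\<in>S. \<forall>y\<in>S. 0 \<le> P t x y) \<and>
     (\<forall>t\<ge>0. \<forall>x\<in>S. (\<Sum>y\<in>S. P t x y) = 1) \<and>
     (\<forall>x\<in>S. \<forall>y\<in>S. P 0 x y = of_bool (x = y)) \<and>
     (\<forall>s\<ge>0. \<forall>t\<ge>0. \<forall>x\<in>S. \<forall>y\<in>S. P (s + t) x y = (\<Sum>z\<in>S. P s x z * P t z y)) \<and>
     (\<forall>x\<in>S. \<forall>y\<in>S. ((\<lambda>t. P t x y) has_real_derivative generator S q x y) (at_right 0))"

text \<open>
  The Markov property is stated multiplicatively, which avoids conditioning on null events.
  The law of \<open>X 0\<close> is arbitrary, and no path regularity is required.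
\<close>

locale finite_ctmc = prob_space M
  for M :: "'w measure" and S :: "'s set" and q :: "'s \<Rightarrow> 's \<Rightarrow> real"
    and P :: "real \<Rightarrow> 's \<Rightarrow> 's \<Rightarrow> real" and X :: "real \<Rightarrow> 'w \<Rightarrow> 's" +
  assumes finite_states: "finite S"
    and trans_fun: "transition_function S q P"
    and random_variable_X: "\<And>t. 0 \<le> t \<Longrightarrow> random_variable (count_space S) (X t)"
    and markov: "\<And>(n::nat) (t :: nat \<Rightarrow> real) (x :: nat \<Rightarrow> 's).
      0 \<le> t 0 \<Longrightarrow> (\<And>i. i \<le> n \<Longrightarrow> t i < t (Suc i)) \<Longrightarrow> (\<And>i. i \<le> Suc n \<Longrightarrow> x i \<in> S) \<Longrightarrow>
      prob {\<omega>\<in>space M. \<forall>i\<le>Suc n. X (t i) \<omega> = x i} =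
      prob {\<omega>\<in>space M. \<forall>i\<le>n. X (t i) \<omega> = x i} * P (t (Suc n) - t n) (x n) (x (Suc n))"

definition limiting_distribution ::
  "'w measure \<Rightarrow> 's set \<Rightarrow> (real \<Rightarrow> 'w \<Rightarrow> 's) \<Rightarrow> ('s \<Rightarrow> real) \<Rightarrow> bool" where
  "limiting_distribution M S X p \<longleftrightarrow>
     (\<forall>x\<in>S. ((\<lambda>t. measure M {\<omega>\<in>space M. X t \<omega> = x}) \<longlongrightarrow> p x) at_top)"

definition stationary_distribution ::
  "'s set \<Rightarrow> (real \<Rightarrow> 's \<Rightarrow> 's \<Rightarrow> real) \<Rightarrow> ('s \<Rightarrow> real) \<Rightarrow> bool" where
  "stationary_distribution S P p \<longleftrightarrow>
     (\<forall>x\<in>S. 0 \<le> p x) \<and> (\<Sum>x\<in>S. p x) = 1 \<and>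
     (\<forall>t\<ge>0. \<forall>y\<in>S. (\<Sum>x\<in>S. p x * P t x y) = p y)"

definition ssep_states :: "nat \<Rightarrow> nat \<Rightarrow> (nat \<Rightarrow> nat) set" where
  "ssep_states N K = {1..N} \<rightarrow>\<^sub>E {0..K}"

definition ssep_rate ::
  "nat \<Rightarrow> nat \<Rightarrow> (nat \<Rightarrow> real) \<Rightarrow> (nat \<Rightarrow> real) \<Rightarrow> (nat \<Rightarrow> real) \<Rightarrow>
    (nat \<Rightarrow> nat) \<Rightarrow> (nat \<Rightarrow> nat) \<Rightarrow> real" where
  "ssep_rate N K \<alpha> \<beta> \<delta> x y = (\<Sum>k\<in>{1..K}.
     (\<Sum>i\<in>{1, N}. if x i = 0 \<and> y = x(i := k) then \<alpha> k else 0) +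
     (\<Sum>i\<in>{1, N}. if x i = k \<and> y = x(i := 0) then \<beta> k else 0) +
     (\<Sum>(i, j)\<in>{(i, j). i \<in> {1..N} \<and> j \<in> {1..N} \<and> (j = i + 1 \<or> i = j + 1)}.
        if x i = k \<and> x j = 0 \<and> y = x(i := 0, j := k) then \<delta> k else 0))"

end

theory Submission imports Defs begin

text \<open>
  Reversing a departure gives an arrival and reversing a hop gives a hop, so for \<open>\<alpha> = \<beta>\<close> the
  rates are symmetric and the columns of the generator sum to zero. The deviation of the column
  sums of \<open>P t\<close> from 1 is subadditive in \<open>t\<close> and \<open>o(t)\<close> at 0, hence zero, so the uniform law is
  stationary. Every state leads to the empty one by pushing the leftmost particle out to the left, so
  some \<open>P T\<close> is entrywise positive, and by Doeblin's argument it is a strict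
  \<open>\<ell>\<^sup>1\<close>-contraction on vectors of total mass 0.
\<close>

section \<open>Finite transition functions\<close>

locale finite_transition =
  fixes S :: "'s set" and q :: "'s \<Rightarrow> 's \<Rightarrow> real" and P :: "real \<Rightarrow> 's \<Rightarrow> 's \<Rightarrow> real"
  assumes finite_S: "finite S"
    and trans_fun: "transition_function S q P"
begin

lemma P_nonneg: "0 \<le> t \<Longrightarrow> x \<in> S \<Longrightarrow> y \<in> S \<Longrightarrow> 0 \<le> P t x y"
  and P_row_sum: "0 \<le> t \<Longrightarrow> x \<in> S \<Longrightarrow> (\<Sum>y\<in>S. P t x y) = 1"
  and P_zero: "x \<in> S \<Longrightarrow> y \<in> S \<Longrightarrow> P 0 x y = of_bool (x = y)"
  and P_add: "0 \<le> s \<Longrightarrow> 0 \<le> t \<Longrightarrow> x \<in> S \<Longrightarrow> y \<in> S \<Longrightarrow>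
    P (s + t) x y = (\<Sum>z\<in>S. P s x z * P t z y)"
  and P_deriv: "x \<in> S \<Longrightarrow> y \<in> S \<Longrightarrow>
    ((\<lambda>t. P t x y) has_real_derivative generator S q x y) (at_right 0)"
  using trans_fun unfolding transition_function_def by blast+

text \<open>The row vector \<open>v\<close> times the matrix \<open>P t\<close>: the law at time
  \<open>t\<close> if \<open>v\<close> is the initial law. Signed \<open>v\<close> are allowed so
  that differences of laws can be evolved too.\<close>

definition evolve :: "real \<Rightarrow> ('s \<Rightarrow> real) \<Rightarrow> 's \<Rightarrow> real" where
  "evolve t v y = (\<Sum>x\<in>S. v x * P t x y)"

lemma evolve_diff: "evolve t (\<lambda>x. v x - w x) y = evolve t v y - evolve t w y"
  by (simp add: evolve_def left_diff_distrib sum_subtractf)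

lemma evolve_zero:
  assumes "y \<in> S"
  shows "evolve 0 v y = v y"
proof -
  have "evolve 0 v y = (\<Sum>x\<in>S. if x = y then v x else 0)"
    unfolding evolve_def using assms by (intro sum.cong) (auto simp: P_zero)
  then show ?thesis using assms finite_S by simp
qed

lemma evolve_add:
  assumes "0 \<le> s" "0 \<le> t" "y \<in> S"
  shows "evolve (s + t) v y = evolve t (evolve s v) y"
proof -
  have "evolve (s + t) v y = (\<Sum>x\<in>S. \<Sum>z\<in>S. v x * (P s x z * P t z y))"
    unfolding evolve_def using assms by (intro sum.cong) (auto simp: P_add sum_distrib_left)
  also have "\<dots> = (\<Sum>z\<in>S. \<Sum>x\<in>S. v x * (P s x z * P t z y))"
    by (rule sum.swap)
  also have "\<dots> = evolve t (evolve s v) y"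
    unfolding evolve_def by (simp add: sum_distrib_right mult.assoc)
  finally show ?thesis .
qed

lemma sum_evolve:
  assumes "0 \<le> t"
  shows "(\<Sum>y\<in>S. evolve t v y) = (\<Sum>x\<in>S. v x)"
proof -
  have "(\<Sum>y\<in>S. evolve t v y) = (\<Sum>x\<in>S. \<Sum>y\<in>S. v x * P t x y)"
    unfolding evolve_def by (rule sum.swap)
  also have "\<dots> = (\<Sum>x\<in>S. v x)"
    using assms by (intro sum.cong) (auto simp: P_row_sum simp flip: sum_distrib_left)
  finally show ?thesis .
qed

text \<open>Doeblin's contraction; the case \<open>\<epsilon> = 0\<close> needs no assumption on the total mass of \<open>v\<close>.\<close>

lemma evolve_contraction:
  fixes v :: "'s \<Rightarrow> real" and \<epsilon> :: real
  assumes t: "0 \<le> t" and min: "\<And>x y. x \<in> S \<Longrightarrow> y \<in> S \<Longrightarrow> \<epsilon> \<le> P t x y"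
    and v: "\<epsilon> * (\<Sum>x\<in>S. v x) = 0"
  shows "(\<Sum>y\<in>S. \<bar>evolve t v y\<bar>) \<le> (1 - card S * \<epsilon>) * (\<Sum>x\<in>S. \<bar>v x\<bar>)"
proof -
  \<comment> \<open>Subtracting \<epsilon> from every entry of \<open>P t\<close> changes
    \<open>evolve t v\<close> by \<epsilon> times the total mass of \<open>v\<close>, which is 0.
    The new entries are nonnegative and each row sums to
    \<open>1 - card S * \<epsilon>\<close>.\<close>
  have "(\<Sum>y\<in>S. \<bar>evolve t v y\<bar>) = (\<Sum>y\<in>S. \<bar>\<Sum>x\<in>S. v x * (P t x y - \<epsilon>)\<bar>)"
    using v by (auto simp: evolve_def right_diff_distrib sum_subtractf simp flip: sum_distrib_right)
  also have "\<dots> \<le> (\<Sum>y\<in>S. \<Sum>x\<in>S. \<bar>v x * (P t x y - \<epsilon>)\<bar>)"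
    by (intro sum_mono sum_abs)
  also have "\<dots> = (\<Sum>y\<in>S. \<Sum>x\<in>S. \<bar>v x\<bar> * (P t x y - \<epsilon>))"
    using min by (intro sum.cong refl) (simp add: abs_mult)
  also have "\<dots> = (\<Sum>x\<in>S. \<Sum>y\<in>S. \<bar>v x\<bar> * (P t x y - \<epsilon>))"
    by (rule sum.swap)
  also have "\<dots> = (\<Sum>x\<in>S. \<bar>v x\<bar> * (1 - card S * \<epsilon>))"
    using t by (auto intro!: sum.cong simp: P_row_sum sum_subtractf simp flip: sum_distrib_left)
  also have "\<dots> = (1 - card S * \<epsilon>) * (\<Sum>x\<in>S. \<bar>v x\<bar>)"
    by (simp add: mult.commute flip: sum_distrib_right)
  finally show ?thesis .
qed

lemma evolve_nonexpansive:
  assumes "0 \<le> t"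
  shows "(\<Sum>y\<in>S. \<bar>evolve t v y\<bar>) \<le> (\<Sum>x\<in>S. \<bar>v x\<bar>)"
  using evolve_contraction[OF assms, of 0 v] P_nonneg[OF assms] by simp

text \<open>\<open>evolve t (\<lambda>_. 1) y\<close> is a column sum of \<open>P t\<close>.
  Derivatives are given at time 0 only, so instead of solving a differential equation the interval
  is cut into n pieces and their errors, each o(t/n), are added up.\<close>

lemma evolve_one:
  assumes gen: "\<And>y. y \<in> S \<Longrightarrow> (\<Sum>x\<in>S. generator S q x y) = 0"
    and t: "0 \<le> t" and y: "y \<in> S"
  shows "evolve t (\<lambda>_. 1) y = 1"
proof (cases "t = 0")
  case True
  then show ?thesis using y by (simp add: evolve_zero)
next
  case False
  with t have t: "0 < t" by simp
  define g where "g s = (\<Sum>y\<in>S. \<bar>evolve s (\<lambda>_. 1) y - 1\<bar>)" for s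
  have g_add: "g (r + s) \<le> g r + g s" if rs: "0 \<le> r" "0 \<le> s" for r s
  proof -
    \<comment> \<open>The error at \<open>r + s\<close> is the error at \<open>r\<close> evolved for
      time \<open>s\<close>, which does not grow in l1, plus the error at \<open>s\<close>.\<close>
    have "evolve (r + s) (\<lambda>_. 1) y - 1 =
        evolve s (\<lambda>z. evolve r (\<lambda>_. 1) z - 1) y + (evolve s (\<lambda>_. 1) y - 1)" if "y \<in> S" for y
      using rs that by (simp add: evolve_add evolve_diff)
    then have "g (r + s) \<le> (\<Sum>y\<in>S. \<bar>evolve s (\<lambda>z. evolve r (\<lambda>_. 1) z - 1) y\<bar>) + g s"
      unfolding g_def by (simp add: sum_mono flip: sum.distrib)
    also have "\<dots> \<le> g r + g s"
      using evolve_nonexpansive[OF rs(2), of "\<lambda>z. evolve r (\<lambda>_. 1) z - 1"]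
      by (simp add: g_def)
    finally show ?thesis .
  qed
  have g_mult: "g (real n * h) \<le> real n * g h" if "0 \<le> h" for n h
  proof (induction n)
    case 0
    then show ?case by (simp add: g_def evolve_zero)
  next
    case (Suc n)
    have "g (real (Suc n) * h) \<le> g (real n * h) + g h"
      using g_add[of "real n * h" h] that by (simp add: algebra_simps)
    with Suc show ?case by (simp add: algebra_simps)
  qed
  have "((\<lambda>h. (evolve h (\<lambda>_. 1) y - 1) / h) \<longlongrightarrow> 0) (at_right 0)" if y: "y \<in> S" for y
  proof -
    have "((\<lambda>h. evolve h (\<lambda>_. 1) y) has_real_derivative (\<Sum>x\<in>S. generator S q x y)) (at_right 0)"
      unfolding evolve_def using y by (auto intro!: DERIV_sum P_deriv)
    then show ?thesis
      using y by (simp add: gen has_field_derivative_iff evolve_zero)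
  qed
  then have "((\<lambda>h. \<Sum>y\<in>S. \<bar>(evolve h (\<lambda>_. 1) y - 1) / h\<bar>) \<longlongrightarrow> (\<Sum>y\<in>S. 0)) (at_right 0)"
    by (intro tendsto_sum tendsto_rabs_zero)
  then have lim: "((\<lambda>h. g h / \<bar>h\<bar>) \<longlongrightarrow> 0) (at_right 0)"
    by (simp add: g_def sum_divide_distrib)
  \<comment> \<open>\<open>Suc n\<close> keeps the step a positive fraction of \<open>t\<close>, so
    it tends to 0 from the right.\<close>
  have "filterlim (\<lambda>n. t / real (Suc n)) (at_right 0) sequentially"
  proof (rule tendsto_imp_filterlim_at_right)
    show "(\<lambda>n. t / real (Suc n)) \<longlonglongrightarrow> 0"
      by (rule LIMSEQ_Suc[OF lim_const_over_n])
  qed (use t in auto)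
  from filterlim_compose[OF lim this]
  have "(\<lambda>n. t * (g (t / real (Suc n)) / \<bar>t / real (Suc n)\<bar>)) \<longlonglongrightarrow> t * 0"
    by (intro tendsto_mult tendsto_const)
  \<comment> \<open>The bound is \<open>real (Suc n) * g (t / real (Suc n))\<close>, written through
    the quotient whose limit is known.\<close>
  moreover have "g t \<le> t * (g (t / real (Suc n)) / \<bar>t / real (Suc n)\<bar>)" for n
    using g_mult[of "t / real (Suc n)" "Suc n"] t by (simp add: mult.commute)
  ultimately have "g t \<le> t * 0"
    by (intro LIMSEQ_le_const) auto
  moreover have "\<bar>evolve t (\<lambda>_. 1) y - 1\<bar> \<le> g t"
    unfolding g_def using y finite_S by (intro member_le_sum) auto
  ultimately show ?thesis by simp
qed

text \<open>On the diagonal, \<open>P h x x\<close> tends to 1. Off it, \<open>P 0 x y\<close> is 0,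
  so the difference quotient is \<open>P h x y / h\<close> and tends to the positive rate.\<close>

lemma eventually_P_pos:
  assumes xy: "x \<in> S" "y \<in> S" and edge: "x = y \<or> 0 < q x y"
  shows "eventually (\<lambda>h. 0 < P h x y) (at_right 0)"
proof (cases "x = y")
  case True
  have "((\<lambda>h. P h x y) \<longlongrightarrow> P 0 x y) (at_right 0)"
    using DERIV_continuous[OF P_deriv[OF xy]] by (simp add: continuous_within)
  then show ?thesis
    by (rule order_tendstoD) (use True xy in \<open>simp add: P_zero\<close>)
next
  case False
  have "((\<lambda>h. P h x y / h) \<longlongrightarrow> q x y) (at_right 0)"
    using P_deriv[OF xy] False xy by (simp add: has_field_derivative_iff P_zero generator_def)
  then have "eventually (\<lambda>h. 0 < P h x y / h) (at_right 0)"
    by (rule order_tendstoD) (use edge False in simp)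
  moreover have "eventually (\<lambda>h::real. 0 < h) (at_right 0)"
    by (rule eventually_at_right_less)
  ultimately show ?thesis
    by eventually_elim (simp add: zero_less_divide_iff)
qed

text \<open>Passing through \<open>y\<close> is one of the nonnegative terms of the
  Chapman-Kolmogorov sum.\<close>

lemma P_add_pos:
  assumes "0 \<le> s" "0 \<le> t" "x \<in> S" "y \<in> S" "z \<in> S" "0 < P s x y" "0 < P t y z"
  shows "0 < P (s + t) x z"
proof -
  have "0 < P s x y * P t y z"
    using assms by simp
  also have "\<dots> \<le> P (s + t) x z"
    using assms finite_S by (subst P_add) (auto intro!: member_le_sum mult_nonneg_nonneg P_nonneg)
  finally show ?thesis .
qed

text \<open>Paths between different pairs differ in length; waiting in a state also has positive
  probability, so all of them can be padded to a common number of steps of length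
  \<open>h\<close>.\<close>

lemma P_pos:
  assumes irr: "\<And>x y. x \<in> S \<Longrightarrow> y \<in> S \<Longrightarrow> (x, y) \<in> {(x, y). x \<in> S \<and> y \<in> S \<and> 0 < q x y}\<^sup>*"
  obtains T where "0 < T" "\<And>x y. x \<in> S \<Longrightarrow> y \<in> S \<Longrightarrow> 0 < P T x y"
proof -
  \<comment> \<open>Finiteness gives one \<open>h\<close> for all edges; the case
    \<open>x = y\<close> is included to permit waiting.\<close>
  have "eventually (\<lambda>h. \<forall>x\<in>S. \<forall>y\<in>S. x = y \<or> 0 < q x y \<longrightarrow> 0 < P h x y) (at_right 0)"
    using finite_S eventually_P_pos by (auto intro!: eventually_ball_finite simp: eventually_conj_iff)
  moreover have "eventually (\<lambda>h::real. 0 < h) (at_right 0)"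
    by (rule eventually_at_right_less)
  ultimately have "eventually (\<lambda>h. 0 < h \<and>
      (\<forall>x\<in>S. \<forall>y\<in>S. x = y \<or> 0 < q x y \<longrightarrow> 0 < P h x y)) (at_right 0)"
    by eventually_elim blast
  from eventually_happens'[OF trivial_limit_at_right_real this] obtain h
    where h: "0 < h" and pos: "\<And>x y. x \<in> S \<Longrightarrow> y \<in> S \<Longrightarrow> x = y \<or> 0 < q x y \<Longrightarrow> 0 < P h x y"
    by blast
  have extend: "0 < P (real (Suc n) * h) x z"
    if "x \<in> S" "y \<in> S" "z \<in> S" "0 < P (real n * h) x y" "y = z \<or> 0 < q y z" for n x y z
    using P_add_pos[of "real n * h" h x y z] pos[of y z] that h by (simp add: algebra_simps)
  have mono: "0 < P (real n * h) x y" if "x \<in> S" "y \<in> S" "m \<le> n" "0 < P (real m * h) x y" for m n x y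
    using that(3)
  proof (induction rule: dec_induct)
    case base
    then show ?case by (fact that(4))
  next
    case (step n)
    then show ?case using extend that by blast
  qed
  have "\<exists>n. 0 < P (real n * h) x y" if "x \<in> S" "y \<in> S" for x y
    using irr[OF that]
  proof (induction rule: rtrancl_induct)
    case base
    show ?case using P_zero[OF that(1) that(1)] by (intro exI[of _ 0]) simp
  next
    case (step y z)
    then show ?case using extend that(1) by blast
  qed
  then obtain n where n: "\<And>x y. x \<in> S \<Longrightarrow> y \<in> S \<Longrightarrow> 0 < P (real (n x y) * h) x y"
    by metis
  \<comment> \<open>The sum bounds every \<open>n x y\<close>, and \<open>Suc\<close> makes the time
    positive even if all of them are 0.\<close>
  define m where "m = Suc (\<Sum>(x, y)\<in>S \<times> S. n x y)"
  have "n x y \<le> m" if "x \<in> S" "y \<in> S" for x y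
    using member_le_sum[of "(x, y)" "S \<times> S" "\<lambda>(x, y). n x y"] that finite_S
    by (simp add: m_def)
  then have "0 < P (real m * h) x y" if "x \<in> S" "y \<in> S" for x y
    using mono n that by blast
  moreover have "0 < real m * h"
    using h unfolding m_def by (intro mult_pos_pos) (simp_all del: of_nat_Suc)
  ultimately show ?thesis using that by blast
qed

text \<open>The l1 norm shrinks by a fixed factor over each period \<open>T\<close> and does not
  grow in between, so it decays geometrically.\<close>

lemma evolve_tendsto_zero:
  assumes irr: "\<And>x y. x \<in> S \<Longrightarrow> y \<in> S \<Longrightarrow> (x, y) \<in> {(x, y). x \<in> S \<and> y \<in> S \<and> 0 < q x y}\<^sup>*"
    and v: "(\<Sum>x\<in>S. v x) = 0" and y: "y \<in> S"
  shows "((\<lambda>t. evolve t v y) \<longlongrightarrow> 0) at_top"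
proof -
  obtain T where T: "0 < T" and pos: "\<And>x y. x \<in> S \<Longrightarrow> y \<in> S \<Longrightarrow> 0 < P T x y"
    using P_pos[OF irr] by blast
  \<comment> \<open>The smallest entry of \<open>P T\<close>; the minimum is over a finite set that
    contains the pair \<open>(y, y)\<close>.\<close>
  define \<epsilon> where "\<epsilon> = Min ((\<lambda>(x, y). P T x y) ` (S \<times> S))"
  have \<epsilon>_pos: "0 < \<epsilon>"
    unfolding \<epsilon>_def using finite_S y pos by (subst Min_gr_iff) auto
  have \<epsilon>_le: "\<epsilon> \<le> P T x y" if "x \<in> S" "y \<in> S" for x y
    unfolding \<epsilon>_def using that finite_S by (intro Min_le) auto
  define c where "c = 1 - card S * \<epsilon>"
  \<comment> \<open>A row of \<open>P T\<close> sums to 1 and has entries at least \<epsilon>, so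
    the contraction factor is not negative.\<close>
  have "card S * \<epsilon> = (\<Sum>z\<in>S. \<epsilon>)" by simp
  also have "\<dots> \<le> (\<Sum>z\<in>S. P T y z)" using y \<epsilon>_le by (intro sum_mono)
  also have "\<dots> = 1" using T y by (simp add: P_row_sum)
  finally have c_nonneg: "0 \<le> c" by (simp add: c_def)
  have "0 < card S" using y finite_S by (auto simp: card_gt_0_iff)
  then have c_less: "c < 1" using \<epsilon>_pos by (simp add: c_def)
  define f where "f t = (\<Sum>y\<in>S. \<bar>evolve t v y\<bar>)" for t
  have f_antimono: "f t \<le> f s" if "0 \<le> s" "s \<le> t" for s t
    using evolve_nonexpansive[of "t - s" "evolve s v"] evolve_add[of s "t - s" _ v] that
    by (simp add: f_def)
  have f_geometric: "f (real n * T) \<le> c ^ n * f 0" for n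
  proof (induction n)
    case (Suc n)
    have nT: "0 \<le> real n * T" using T by simp
    have "f (real (Suc n) * T) = (\<Sum>y\<in>S. \<bar>evolve T (evolve (real n * T) v) y\<bar>)"
      using evolve_add[OF nT, of T _ v] T by (simp add: f_def algebra_simps)
    also have "\<dots> \<le> c * f (real n * T)"
      \<comment> \<open>Evolution preserves total mass 0, so the contraction applies again in every
        period.\<close>
      unfolding c_def f_def using T \<epsilon>_le sum_evolve[OF nT, of v] v
      by (intro evolve_contraction) auto
    also have "\<dots> \<le> c * (c ^ n * f 0)"
      using Suc c_nonneg by (intro mult_left_mono)
    finally show ?case by simp
  qed simp
  have "(\<lambda>n. c ^ n * f 0) \<longlonglongrightarrow> 0"
    using c_nonneg c_less by (auto intro!: tendsto_mult_left_zero LIMSEQ_power_zero)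
  \<comment> \<open>The floor counts the periods completed by time \<open>t\<close>.\<close>
  moreover have "filterlim (\<lambda>t. nat \<lfloor>t / T\<rfloor>) sequentially at_top"
    using T by real_asymp
  ultimately have "((\<lambda>t. c ^ nat \<lfloor>t / T\<rfloor> * f 0) \<longlongrightarrow> 0) at_top"
    by (rule filterlim_compose)
  then show ?thesis
  proof (rule Lim_null_comparison[rotated])
    have bound: "\<bar>evolve t v y\<bar> \<le> c ^ nat \<lfloor>t / T\<rfloor> * f 0" if t: "0 \<le> t" for t
    proof -
      have "\<bar>evolve t v y\<bar> \<le> f t"
        unfolding f_def using y finite_S by (intro member_le_sum) auto
      also have "\<dots> \<le> f (real (nat \<lfloor>t / T\<rfloor>) * T)"
      proof (rule f_antimono)
        have "real (nat \<lfloor>t / T\<rfloor>) \<le> t / T" using t T by simp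
        then show "real (nat \<lfloor>t / T\<rfloor>) * T \<le> t" using T by (simp add: field_simps)
      qed (use T in simp)
      also note f_geometric
      finally show ?thesis .
    qed
    show "eventually (\<lambda>t. norm (evolve t v y) \<le> c ^ nat \<lfloor>t / T\<rfloor> * f 0) at_top"
      using eventually_ge_at_top[of 0] by eventually_elim (simp add: bound)
  qed
qed

end

section \<open>Symmetric irreducible rates\<close>

locale symmetric_transition = finite_transition +
  assumes sym: "\<And>x y. x \<in> S \<Longrightarrow> y \<in> S \<Longrightarrow> q x y = q y x"
    and irreducible: "\<And>x y. x \<in> S \<Longrightarrow> y \<in> S \<Longrightarrow>
      (x, y) \<in> {(x, y). x \<in> S \<and> y \<in> S \<and> 0 < q x y}\<^sup>*"
begin

text \<open>By symmetry the off-diagonal entries of a column are the exit rates that its diagonal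
  entry subtracts.\<close>

lemma generator_column_sum:
  assumes "y \<in> S"
  shows "(\<Sum>x\<in>S. generator S q x y) = 0"
proof -
  have "(\<Sum>x\<in>S. generator S q x y) = generator S q y y + (\<Sum>x\<in>S - {y}. generator S q x y)"
    using assms finite_S by (rule sum.remove[rotated])
  also have "(\<Sum>x\<in>S - {y}. generator S q x y) = (\<Sum>x\<in>S - {y}. q y x)"
    using assms by (intro sum.cong) (auto simp: generator_def sym)
  finally show ?thesis by (simp add: generator_def)
qed

lemma evolve_const:
  assumes "0 \<le> t" "y \<in> S"
  shows "evolve t (\<lambda>_. c) y = c"
proof -
  have "evolve t (\<lambda>_. c) y = c * evolve t (\<lambda>_. 1) y"
    by (simp add: evolve_def sum_distrib_left)
  then show ?thesis
    using evolve_one[OF generator_column_sum] assms by simp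
qed

text \<open>The uniform vector is fixed by the evolution, and its difference from \<open>v\<close>
  has total mass 0 and hence dies out.\<close>

lemma evolve_tendsto_uniform:
  assumes v: "(\<Sum>x\<in>S. v x) = 1" and y: "y \<in> S"
  shows "((\<lambda>t. evolve t v y) \<longlongrightarrow> 1 / card S) at_top"
proof -
  have "card S \<noteq> 0" using y finite_S by auto
  then have "(\<Sum>x\<in>S. v x - 1 / card S) = 0"
    using v by (simp add: sum_subtractf)
  from evolve_tendsto_zero[OF irreducible this y]
  have "((\<lambda>t. evolve t v y - evolve t (\<lambda>_. 1 / card S) y) \<longlongrightarrow> 0) at_top"
    by (simp add: evolve_diff)
  moreover have "eventually (\<lambda>t. evolve t v y - evolve t (\<lambda>_. 1 / card S) y =
      evolve t v y - 1 / card S) at_top"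
    using eventually_ge_at_top[of 0] by eventually_elim (simp add: evolve_const y)
  ultimately have "((\<lambda>t. evolve t v y - 1 / card S) \<longlongrightarrow> 0) at_top"
    by (rule Lim_transform_eventually)
  then show ?thesis by (simp add: LIM_zero_iff)
qed

text \<open>Uniqueness comes from convergence: a stationary \<open>p\<close> does not move, yet its
  evolution tends to the uniform vector.\<close>

lemma stationary_distribution_iff_uniform:
  assumes "S \<noteq> {}"
  shows "stationary_distribution S P p \<longleftrightarrow> (\<forall>x\<in>S. p x = 1 / card S)"
proof
  assume p: "stationary_distribution S P p"
  show "\<forall>x\<in>S. p x = 1 / card S"
  proof
    fix x assume x: "x \<in> S"
    have "((\<lambda>t. evolve t p x) \<longlongrightarrow> 1 / card S) at_top"
      using p x by (intro evolve_tendsto_uniform) (auto simp: stationary_distribution_def)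
    moreover have "eventually (\<lambda>t. evolve t p x = p x) at_top"
      using eventually_ge_at_top[of 0]
      by eventually_elim (use p x in \<open>simp add: stationary_distribution_def evolve_def\<close>)
    ultimately have "((\<lambda>_. p x) \<longlongrightarrow> 1 / card S) (at_top :: real filter)"
      by (rule Lim_transform_eventually)
    then show "p x = 1 / card S"
      by (simp add: tendsto_const_iff)
  qed
next
  assume p: "\<forall>x\<in>S. p x = 1 / card S"
  have "(\<Sum>x\<in>S. p x * P t x y) = p y" if "0 \<le> t" "y \<in> S" for t y
    using evolve_const[OF that, of "1 / card S"] p that by (simp add: evolve_def)
  moreover have "(\<Sum>x\<in>S. p x) = 1"
    using p assms finite_S by simp
  ultimately show "stationary_distribution S P p"
    using p by (simp add: stationary_distribution_def)
qed

end

section \<open>The one-dimensional laws of a finite chain\<close>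

context finite_ctmc
begin

text \<open>Splits \<open>A\<close> by the state at time \<open>t\<close>. It serves at time 0, for
  the event of a given later state and for the whole space.\<close>

lemma sum_prob_states:
  assumes "0 \<le> t" and A: "A \<in> events"
  shows "(\<Sum>x\<in>S. prob {\<omega>\<in>space M. \<omega> \<in> A \<and> X t \<omega> = x}) = prob A"
proof -
  have X: "X t \<in> measurable M (count_space S)"
    using assms(1) by (rule random_variable_X)
  have meas: "{\<omega>\<in>space M. \<omega> \<in> A \<and> X t \<omega> = x} \<in> events" if "x \<in> S" for x
  proof -
    have "{\<omega>\<in>space M. \<omega> \<in> A \<and> X t \<omega> = x} = A \<inter> (X t -` {x} \<inter> space M)"
      using sets.sets_into_space[OF A] by auto
    then show ?thesis using measurable_sets[OF X, of "{x}"] A that by auto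
  qed
  have "A = (\<Union>x\<in>S. {\<omega>\<in>space M. \<omega> \<in> A \<and> X t \<omega> = x})"
    using measurable_space[OF X] sets.sets_into_space[OF A] by auto
  then have "prob A = prob (\<Union>x\<in>S. {\<omega>\<in>space M. \<omega> \<in> A \<and> X t \<omega> = x})" by simp
  also have "\<dots> = (\<Sum>x\<in>S. prob {\<omega>\<in>space M. \<omega> \<in> A \<and> X t \<omega> = x})"
    using meas by (intro finite_measure_finite_Union finite_states)
      (auto simp: disjoint_family_on_def)
  finally show ?thesis by simp
qed

lemma prob_state:
  assumes t: "0 < t" and y: "y \<in> S"
  shows "prob {\<omega>\<in>space M. X t \<omega> = y} = (\<Sum>x\<in>S. prob {\<omega>\<in>space M. X 0 \<omega> = x} * P t x y)"
proof -
  have joint: "prob {\<omega>\<in>space M. X 0 \<omega> = x \<and> X t \<omega> = y} = prob {\<omega>\<in>space M. X 0 \<omega> = x} * P t x y"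
    if "x \<in> S" for x
  proof -
    have two: "(\<forall>i\<le>Suc 0. Q i) \<longleftrightarrow> Q 0 \<and> Q 1" for Q :: "nat \<Rightarrow> bool"
      by (auto simp: le_Suc_eq)
    show ?thesis
      \<comment> \<open>The case \<open>n = 0\<close> of the Markov property, with times 0 and
        \<open>t\<close> and states \<open>x\<close> and \<open>y\<close>; strictly increasing times
        require \<open>0 < t\<close>.\<close>
      using markov[of "\<lambda>i. real i * t" 0 "\<lambda>i. if i = 0 then x else y"] t y that
      by (simp add: two)
  qed
  have "{\<omega>\<in>space M. X t \<omega> = y} = X t -` {y} \<inter> space M" by auto
  then have "{\<omega>\<in>space M. X t \<omega> = y} \<in> events"
    using measurable_sets[OF random_variable_X, of t "{y}"] t y by simp
  from sum_prob_states[OF order_refl this]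
  have "prob {\<omega>\<in>space M. X t \<omega> = y} = (\<Sum>x\<in>S. prob {\<omega>\<in>space M. X 0 \<omega> = x \<and> X t \<omega> = y})"
    by (simp add: conj_ac cong: conj_cong)
  also have "\<dots> = (\<Sum>x\<in>S. prob {\<omega>\<in>space M. X 0 \<omega> = x} * P t x y)"
    using joint by (intro sum.cong) auto
  finally show ?thesis .
qed

text \<open>For positive times the law of \<open>X t\<close> is the evolved law of
  \<open>X 0\<close>, which has total mass 1.\<close>

lemma limiting_distribution_uniform:
  assumes "symmetric_transition S q P"
  shows "limiting_distribution M S X (\<lambda>_. 1 / card S)"
proof -
  interpret symmetric_transition S q P by fact
  show ?thesis
    unfolding limiting_distribution_def
  proof
    fix y assume y: "y \<in> S"
    have "(\<Sum>x\<in>S. prob {\<omega>\<in>space M. X 0 \<omega> = x}) = 1"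
      using sum_prob_states[of 0 "space M"] by (simp add: prob_space)
    from evolve_tendsto_uniform[OF this y]
    show "((\<lambda>t. prob {\<omega>\<in>space M. X t \<omega> = y}) \<longlongrightarrow> 1 / card S) at_top"
      by (rule Lim_transform_eventually)
        (use eventually_gt_at_top[of 0] in eventually_elim, simp add: prob_state y evolve_def)
  qed
qed

end

section \<open>Rates of the exclusion process\<close>

lemma finite_ssep_states: "finite (ssep_states N K)"
  by (simp add: ssep_states_def finite_PiE)

lemma card_ssep_states: "card (ssep_states N K) = (K + 1) ^ N"
  by (simp add: ssep_states_def card_PiE)

lemma ssep_statesD: "x \<in> ssep_states N K \<Longrightarrow> i \<in> {1..N} \<Longrightarrow> x i \<le> K"
  by (auto simp: ssep_states_def)

lemma fun_upd_ssep_states: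
  "x \<in> ssep_states N K \<Longrightarrow> i \<in> {1..N} \<Longrightarrow> k \<le> K \<Longrightarrow> x(i := k) \<in> ssep_states N K"
  by (auto simp: ssep_states_def PiE_iff extensional_def)

abbreviation adjacent_sites :: "nat \<Rightarrow> (nat \<times> nat) set" where
  "adjacent_sites N \<equiv> {(i, j). i \<in> {1..N} \<and> j \<in> {1..N} \<and> (j = i + 1 \<or> i = j + 1)}"

lemma finite_adjacent_sites: "finite (adjacent_sites N)"
  by (rule finite_subset[of _ "{1..N} \<times> {1..N}"]) auto

lemma ssep_rate_symmetric:
  assumes "\<And>k. k \<in> {1..K} \<Longrightarrow> \<alpha> k = \<beta> k"
  shows "ssep_rate N K \<alpha> \<beta> \<delta> x y = ssep_rate N K \<alpha> \<beta> \<delta> y x"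
proof -
  \<comment> \<open>An arrival of type \<open>k\<close> from \<open>x\<close> to \<open>y\<close> is
    a departure of type \<open>k\<close> from \<open>y\<close> to \<open>x\<close>.\<close>
  have arrival: "x i = 0 \<and> y = x(i := k) \<longleftrightarrow> y i = k \<and> x = y(i := 0)" for i k and x y :: "nat \<Rightarrow> nat"
    by auto
  \<comment> \<open>A hop from \<open>i\<close> to \<open>j\<close> is undone by a hop from
    \<open>j\<close> to \<open>i\<close>, so swapping the ordered pairs matches the terms.\<close>
  have hop: "(\<Sum>(i, j)\<in>adjacent_sites N. if x i = k \<and> x j = 0 \<and> y = x(i := 0, j := k) then \<delta> k else 0) =
      (\<Sum>(i, j)\<in>adjacent_sites N. if y i = k \<and> y j = 0 \<and> x = y(i := 0, j := k) then \<delta> k else 0)"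
    for k
  proof (rule sum.reindex_bij_witness[of _ prod.swap prod.swap])
    fix a assume "a \<in> adjacent_sites N"
    then obtain i j where a: "a = (i, j)" "i \<noteq> j" by auto
    have "x i = k \<and> x j = 0 \<and> y = x(i := 0, j := k) \<longleftrightarrow> y j = k \<and> y i = 0 \<and> x = y(j := 0, i := k)"
      using a(2) by (auto simp: fun_eq_iff)
    then show "(case prod.swap a of (i, j) \<Rightarrow> if y i = k \<and> y j = 0 \<and> x = y(i := 0, j := k) then \<delta> k else 0) =
        (case a of (i, j) \<Rightarrow> if x i = k \<and> x j = 0 \<and> y = x(i := 0, j := k) then \<delta> k else 0)"
      using a(1) by simp
  qed auto
  show ?thesis
    unfolding ssep_rate_def
  proof (rule sum.cong[OF refl])
    fix k assume "k \<in> {1..K}"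
    then have \<alpha>: "\<alpha> k = \<beta> k" by (rule assms)
    show "(\<Sum>i\<in>{1, N}. if x i = 0 \<and> y = x(i := k) then \<alpha> k else 0) +
        (\<Sum>i\<in>{1, N}. if x i = k \<and> y = x(i := 0) then \<beta> k else 0) +
        (\<Sum>(i, j)\<in>adjacent_sites N. if x i = k \<and> x j = 0 \<and> y = x(i := 0, j := k) then \<delta> k else 0) =
        (\<Sum>i\<in>{1, N}. if y i = 0 \<and> x = y(i := k) then \<alpha> k else 0) +
        (\<Sum>i\<in>{1, N}. if y i = k \<and> x = y(i := 0) then \<beta> k else 0) +
        (\<Sum>(i, j)\<in>adjacent_sites N. if y i = k \<and> y j = 0 \<and> x = y(i := 0, j := k) then \<delta> k else 0)"
      \<comment> \<open>Both arrival sums turn into departure sums of the reversed move, after which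
        the two sides differ only in the order of the first two summands.\<close>
      unfolding hop \<alpha> arrival[of x _ y] arrival[of y _ x] by simp
  qed
qed

section \<open>Positive rates and irreducibility of the exclusion process\<close>

context
  fixes N K :: nat and \<alpha> \<beta> \<delta> :: "nat \<Rightarrow> real"
  assumes \<alpha>: "\<And>k. k \<in> {1..K} \<Longrightarrow> 0 \<le> \<alpha> k"
    and \<beta>: "\<And>k. k \<in> {1..K} \<Longrightarrow> 0 < \<beta> k"
    and \<delta>: "\<And>k. k \<in> {1..K} \<Longrightarrow> 0 < \<delta> k"
begin

text \<open>All terms of the rate are nonnegative, so the departure term of type \<open>x 1\<close>
  at site 1 already makes it positive.\<close>

lemma ssep_rate_departure_pos:
  assumes "x 1 \<in> {1..K}"
  shows "0 < ssep_rate N K \<alpha> \<beta> \<delta> x (x(1 := 0))"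
  unfolding ssep_rate_def
proof (rule sum_pos2[OF _ assms])
  show "0 < (\<Sum>i\<in>{1, N}. if x i = 0 \<and> x(1 := 0) = x(i := x 1) then \<alpha> (x 1) else 0) +
      (\<Sum>i\<in>{1, N}. if x i = x 1 \<and> x(1 := 0) = x(i := 0) then \<beta> (x 1) else 0) +
      (\<Sum>(i, j)\<in>adjacent_sites N.
        if x i = x 1 \<and> x j = 0 \<and> x(1 := 0) = x(i := 0, j := x 1) then \<delta> (x 1) else 0)"
    using \<alpha>[OF assms] \<beta>[OF assms] \<delta>[OF assms]
    by (intro add_pos_nonneg add_nonneg_pos sum_nonneg sum_pos2[of _ 1]) auto
qed (auto intro!: add_nonneg_nonneg sum_nonneg simp: \<alpha> less_imp_le[OF \<beta>] less_imp_le[OF \<delta>])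

text \<open>Here the positive term is the hop of type \<open>x i\<close> for the pair
  \<open>(i, j)\<close>.\<close>

lemma ssep_rate_hop_pos:
  assumes "(i, j) \<in> adjacent_sites N" "x i \<in> {1..K}" "x j = 0"
  shows "0 < ssep_rate N K \<alpha> \<beta> \<delta> x (x(i := 0, j := x i))"
  unfolding ssep_rate_def
proof (rule sum_pos2[OF _ assms(2)])
  let ?y = "x(i := 0, j := x i)"
  show "0 < (\<Sum>l\<in>{1, N}. if x l = 0 \<and> ?y = x(l := x i) then \<alpha> (x i) else 0) +
      (\<Sum>l\<in>{1, N}. if x l = x i \<and> ?y = x(l := 0) then \<beta> (x i) else 0) +
      (\<Sum>(l, j)\<in>adjacent_sites N.
        if x l = x i \<and> x j = 0 \<and> ?y = x(l := 0, j := x i) then \<delta> (x i) else 0)"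
    using \<alpha>[OF assms(2)] \<beta>[OF assms(2)] \<delta>[OF assms(2)] assms(3)
    by (intro add_nonneg_pos add_nonneg_nonneg sum_nonneg
        sum_pos2[OF finite_adjacent_sites assms(1)]) auto
qed (auto intro!: add_nonneg_nonneg sum_nonneg simp: \<alpha> less_imp_le[OF \<beta>] less_imp_le[OF \<delta>])

abbreviation ssep_edges :: "((nat \<Rightarrow> nat) \<times> (nat \<Rightarrow> nat)) set" where
  "ssep_edges \<equiv> {(x, y). x \<in> ssep_states N K \<and> y \<in> ssep_states N K \<and> 0 < ssep_rate N K \<alpha> \<beta> \<delta> x y}"

text \<open>The sum of the occupied positions drops by 1 in each step of the leftmost particle.\<close>

lemma ssep_reach_empty:
  assumes "x \<in> ssep_states N K"
  shows "(x, \<lambda>i\<in>{1..N}. 0) \<in> ssep_edges\<^sup>*"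
  using assms
proof (induction "\<Sum>i\<in>{1..N}. if x i = 0 then 0 else i" arbitrary: x rule: less_induct)
  case less
  show ?case
  proof (cases "\<forall>i\<in>{1..N}. x i = 0")
    case True
    then have "x = (\<lambda>i\<in>{1..N}. 0)"
      using less.prems by (auto simp: ssep_states_def PiE_iff extensional_def fun_eq_iff)
    then show ?thesis by simp
  next
    case False
    define i where "i = (LEAST i. i \<in> {1..N} \<and> x i \<noteq> 0)"
    have i: "i \<in> {1..N}" "x i \<noteq> 0"
      using LeastI_ex[of "\<lambda>i. i \<in> {1..N} \<and> x i \<noteq> 0"] False unfolding i_def by blast+
    have least: "x j = 0" if "j \<in> {1..N}" "j < i" for j
      using not_less_Least[of j "\<lambda>i. i \<in> {1..N} \<and> x i \<noteq> 0"] that unfolding i_def by blast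
    have k: "x i \<in> {1..K}"
      using ssep_statesD[OF less.prems i(1)] i(2) by simp
    \<comment> \<open>The leftmost particle leaves from site 1 or moves to site
      \<open>i - 1\<close>, which is vacant because \<open>i\<close> is least.\<close>
    define y where "y = (if i = 1 then x(1 := 0) else x(i := 0, i - 1 := x i))"
    have y: "y \<in> ssep_states N K"
      using less.prems i k by (auto simp: y_def intro!: fun_upd_ssep_states)
    have "0 < ssep_rate N K \<alpha> \<beta> \<delta> x y"
    proof (cases "i = 1")
      case True
      then show ?thesis using ssep_rate_departure_pos[of x] k by (simp add: y_def)
    next
      case False
      then have "x (i - 1) = 0" using i by (intro least) auto
      moreover have "(i, i - 1) \<in> adjacent_sites N" using False i by auto
      ultimately show ?thesis
        using ssep_rate_hop_pos[of i "i - 1" x] k False by (simp add: y_def)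
    qed
    then have edge: "(x, y) \<in> ssep_edges" using y less.prems by simp
    have "(\<Sum>j\<in>{1..N}. if y j = 0 then 0 else j) < (\<Sum>j\<in>{1..N}. if x j = 0 then 0 else j)"
    proof (cases "i = 1")
      case True
      then show ?thesis
        using i by (intro sum_strict_mono_ex1) (auto simp: y_def)
    next
      case False
      define f where "f z j = (if z j = 0 then 0 else j)" for z :: "nat \<Rightarrow> nat" and j
      have sub: "{i - 1, i} \<subseteq> {1..N}" using i False by auto
      \<comment> \<open>Only the terms at \<open>i - 1\<close> and \<open>i\<close> change: together
        they drop from \<open>i\<close> to \<open>i - 1\<close>.\<close>
      have split: "(\<Sum>j\<in>{1..N}. f z j) = (\<Sum>j\<in>{1..N} - {i - 1, i}. f z j) + (f z (i - 1) + f z i)" for z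
      proof -
        have "i - 1 \<noteq> i" using i(1) by auto
        then show ?thesis using sum.subset_diff[OF sub, of "f z"] by simp
      qed
      have "(\<Sum>j\<in>{1..N} - {i - 1, i}. f y j) = (\<Sum>j\<in>{1..N} - {i - 1, i}. f x j)"
        using False by (intro sum.cong) (auto simp: f_def y_def)
      moreover have "f y (i - 1) + f y i < f x (i - 1) + f x i"
        using False i by (auto simp: f_def y_def)
      ultimately have "(\<Sum>j\<in>{1..N}. f y j) < (\<Sum>j\<in>{1..N}. f x j)"
        unfolding split by simp
      then show ?thesis by (simp add: f_def)
    qed
    from less.hyps[OF this y] edge show ?thesis
      by (rule converse_rtrancl_into_rtrancl[rotated])
  qed
qed

text \<open>Symmetric rates allow every path to the empty state to be reversed, so any two states
  are joined through it.\<close>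

lemma ssep_irreducible:
  assumes eq: "\<And>k. k \<in> {1..K} \<Longrightarrow> \<alpha> k = \<beta> k"
    and "x \<in> ssep_states N K" "y \<in> ssep_states N K"
  shows "(x, y) \<in> ssep_edges\<^sup>*"
proof -
  have "sym ssep_edges"
    using ssep_rate_symmetric[of K \<alpha> \<beta> N \<delta>, OF eq] by (auto simp: sym_def)
  then have "(\<lambda>i\<in>{1..N}. 0, y) \<in> ssep_edges\<^sup>*"
    by (rule symD[OF sym_rtrancl ssep_reach_empty[OF assms(3)]])
  with ssep_reach_empty[OF assms(2)] show ?thesis by (rule rtrancl_trans)
qed

end

theorem theorem7:
  fixes N K :: nat and \<alpha> \<beta> \<delta> :: "nat \<Rightarrow> real"
    and M :: "'w measure" and P :: "real \<Rightarrow> (nat \<Rightarrow> nat) \<Rightarrow> (nat \<Rightarrow> nat) \<Rightarrow> real"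
    and X :: "real \<Rightarrow> 'w \<Rightarrow> nat \<Rightarrow> nat"
  assumes "N \<ge> 2" and "K \<ge> 1"
    and "\<And>k. k \<in> {1..K} \<Longrightarrow> \<alpha> k > 0"
    and "\<And>k. k \<in> {1..K} \<Longrightarrow> \<beta> k > 0"
    and "\<And>k. k \<in> {1..K} \<Longrightarrow> \<delta> k > 0"
    and "finite_ctmc M (ssep_states N K) (ssep_rate N K \<alpha> \<beta> \<delta>) P X"
    and "\<And>k. k \<in> {1..K} \<Longrightarrow> \<alpha> k = \<beta> k"
  shows "limiting_distribution M (ssep_states N K) X (\<lambda>x. 1 / (real K + 1) ^ N) \<and>
    (\<forall>p. stationary_distribution (ssep_states N K) P p \<longleftrightarrow>
      (\<forall>x\<in>ssep_states N K. p x = 1 / (real K + 1) ^ N))"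
proof -
  interpret finite_ctmc M "ssep_states N K" "ssep_rate N K \<alpha> \<beta> \<delta>" P X by fact
  have chain: "symmetric_transition (ssep_states N K) (ssep_rate N K \<alpha> \<beta> \<delta>) P"
  proof unfold_locales
    show "ssep_rate N K \<alpha> \<beta> \<delta> x y = ssep_rate N K \<alpha> \<beta> \<delta> y x" for x y
      using assms(7) by (rule ssep_rate_symmetric)
    show "(x, y) \<in> (ssep_edges N K \<alpha> \<beta> \<delta>)\<^sup>*"
      if "x \<in> ssep_states N K" "y \<in> ssep_states N K" for x y
      using assms(3-5,7) that by (intro ssep_irreducible) (auto intro: less_imp_le)
  qed (use finite_ssep_states trans_fun in auto)
  have card: "real (card (ssep_states N K)) = (real K + 1) ^ N"
    by (simp add: card_ssep_states add.commute)
  \<comment> \<open>The cardinality is a power of a positive number, hence not 0.\<close>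
  then have "ssep_states N K \<noteq> {}" by auto
  then show ?thesis
    using limiting_distribution_uniform[OF chain]
      symmetric_transition.stationary_distribution_iff_uniform[OF chain]
    unfolding card by blast
qed

end
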